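(* Let $\Gamma$ be a finitely generated group with a finite symmetric generating set $S$ containing the identity. Let $(X,d)$ be a locally compact metric space equipped with a Radon measure $\nu$, and let $\Gamma\curvearrowright X$ be a continuous action. Let $(\mathcal{P}_n)_{n\in\mathbb{N}}$ be a sequence of measurable partitions of $X$ with uniformly bounded measure ratios (i.e. there is one constant $Q\ge 1$ bounding the measure ratios of all the $\mathcal{P}_n$). Assume that for every compact set $K\subseteq X$ there is a decreasing sequence of positive numbers $(r_{K,n})_{n\in\mathbb{N}}$ such that $r_{K,n}\to 0$ and $\nu(E_{K,n})\to 0$ as $n\to\infty$, where \[ E_{K,n}:=\bigcup\{R \mid R\in\mathcal{P}_n,\ \nu(R\cap K)>0,\ \operatorname{diam}(R)>r_{K,n}\}. \] Then the action $\Gamma\curvearrowright (X,\nu)$ is expanding in measure if and only if there is a constant $\varepsilon>0$ such that the approximating graphs satisfy $h(\mathcal{G}(\mathcal{P}_n))\ge\varepsilon$ for all $n$.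
   Context: Radon measure: a measure on the Borel $\sigma$-algebra that is locally finite (every point has a neighbourhood of finite measure) and inner regular (the measure of every measurable set is the supremum of the measures of its compact subsets). Continuous action: every $g\in\Gamma$ acts by a homeomorphism. $S\cdot A:=\bigcup_{s\in S}s\cdot A$. The action is \emph{expanding in measure} if there is $\alpha>0$ such that $\nu(S\cdot A)\ge(1+\alpha)\nu(A)$ for every measurable $A\subset X$ with finite measure and $\nu(A)\le\nu(X)/2$ (the latter condition is vacuous when $\nu(X)=\infty$). A \emph{measurable partition} of $(X,\nu)$ is a countable family $\mathcal{P}=\{R_i\mid i\in I\}$ of disjoint measurable subsets (regions) with $\nu(X\smallsetminus\bigsqcup_i R_i)=0$. It has \emph{measure ratios bounded by $Q\ge1$} if every region has finite measure and $\frac1Q\le\frac{\nu(R_i)}{\nu(R_j)}\le Q$ for all $R_i,R_j\in\mathcal{P}$. The \emph{approximating graph} $\mathcal{G}(\mathcal{P})$ is the simplicial non-oriented graph with vertex set $\mathcal{P}$ in which $(R_i,R_j)$ is an edge if and only if there is $s\in S$ with $\nu((s\cdot R_i)\cap R_j)\ne0$. For a graph $\mathcal{G}$ with vertex set $V(\mathcal{G})$ (possibly infinite, possibly of unbounded degree) and $W\subset V(\mathcal{G})$, $\partial W$ is the set of vertices not in $W$ joined by an edge to a vertex of $W$. The \emph{Cheeger constant} is $h(\mathcal{G}):=\inf\{|\partial W|/|W| : W\subset V(\mathcal{G}) \text{ finite, nonempty},\ |W|\le\frac12|V(\mathcal{G})|\}$ (the cardinality condition is vacuous if $V(\mathcal{G})$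 is infinite).
   Formalization: The formal theorem additionally assumes that the relation defining the edges of each approximating graph G(P_n) is symmetric, so that the non-oriented graph exists; this is automatic when the action preserves null sets but can fail for a general continuous action. *)

theory Defs
  imports "HOL-Analysis.Analysis" "HOL-Algebra.Group_Action" "HOL-Algebra.Generated_Groups"
begin

definition radon_measure :: "'x::topological_space measure \<Rightarrow> bool" where
  "radon_measure \<nu> \<longleftrightarrow>
     sets \<nu> = sets borel \<and>
     (\<forall>x. \<exists>U. open U \<and> x \<in> U \<and> emeasure \<nu> U < \<infinity>) \<and>
     (\<forall>A \<in> sets \<nu>. emeasure \<nu> A = (SUP K \<in> {K. compact K \<and> K \<subseteq> A}. emeasure \<nu> K))"

definition continuous_action ::
    "('g, 'b) monoid_scheme \<Rightarrow> ('g \<Rightarrow> 'x::topological_space \<Rightarrow> 'x) \<Rightarrow> bool" where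
  "continuous_action G \<phi> \<longleftrightarrow>
     group_action G UNIV \<phi> \<and> (\<forall>g \<in> carrier G. homeomorphic_map euclidean euclidean (\<phi> g))"

definition act_set :: "('g \<Rightarrow> 'x \<Rightarrow> 'x) \<Rightarrow> 'g set \<Rightarrow> 'x set \<Rightarrow> 'x set" where
  "act_set \<phi> S A = (\<Union>s\<in>S. \<phi> s ` A)"

(* In ennreal, \<infinity> / 2 = \<infinity>, so the second bound on A is vacuous when the space has infinite measure. *)
definition expanding_in_measure :: "'x measure \<Rightarrow> ('g \<Rightarrow> 'x \<Rightarrow> 'x) \<Rightarrow> 'g set \<Rightarrow> bool" where
  "expanding_in_measure \<nu> \<phi> S \<longleftrightarrow>
     (\<exists>\<alpha>::real. \<alpha> > 0 \<and>
       (\<forall>A \<in> sets \<nu>. emeasure \<nu> A < \<infinity> \<longrightarrow> emeasure \<nu> A \<le> emeasure \<nu> (space \<nu>) / 2 \<longrightarrow>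
          emeasure \<nu> (act_set \<phi> S A) \<ge> ennreal (1 + \<alpha>) * emeasure \<nu> A))"

definition measurable_partition :: "'x measure \<Rightarrow> 'x set set \<Rightarrow> bool" where
  "measurable_partition \<nu> P \<longleftrightarrow>
     countable P \<and> P \<subseteq> sets \<nu> \<and> disjoint P \<and> emeasure \<nu> (space \<nu> - \<Union>P) = 0"

(* All regions have positive measure: for R' = R a null R would give the quotient 0 < 1 / Q. *)
definition measure_ratios_bounded :: "'x measure \<Rightarrow> real \<Rightarrow> 'x set set \<Rightarrow> bool" where
  "measure_ratios_bounded \<nu> Q P \<longleftrightarrow>
     (\<forall>R\<in>P. emeasure \<nu> R < \<infinity>) \<and>
     (\<forall>R\<in>P. \<forall>R'\<in>P. 1 / Q \<le> measure \<nu> R / measure \<nu> R' \<and> measure \<nu> R / measure \<nu> R' \<le> Q)"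

(* The real-valued library constant diameter is meaningless on unbounded sets; here they have
   diameter \<infinity>. *)
definition ediam :: "'x::metric_space set \<Rightarrow> ennreal" where
  "ediam R = (SUP x\<in>R. SUP y\<in>R. ennreal (dist x y))"

definition large_regions ::
    "'x::metric_space measure \<Rightarrow> 'x set set \<Rightarrow> 'x set \<Rightarrow> real \<Rightarrow> 'x set" where
  "large_regions \<nu> P K r = \<Union>{R \<in> P. emeasure \<nu> (R \<inter> K) > 0 \<and> ediam R > ennreal r}"

(* Graphs are given by a vertex set V and a set E of ordered pairs; a simplicial non-oriented
   graph has no loops and a symmetric E. *)
definition simplicial_graph :: "'v set \<Rightarrow> ('v \<times> 'v) set \<Rightarrow> bool" where
  "simplicial_graph V E \<longleftrightarrow> E \<subseteq> V \<times> V \<and> irrefl E \<and> sym E"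

definition approx_edges ::
    "'x measure \<Rightarrow> ('g \<Rightarrow> 'x \<Rightarrow> 'x) \<Rightarrow> 'g set \<Rightarrow> 'x set set \<Rightarrow> ('x set \<times> 'x set) set" where
  "approx_edges \<nu> \<phi> S P =
     {(R, R'). R \<in> P \<and> R' \<in> P \<and> R \<noteq> R' \<and> (\<exists>s\<in>S. emeasure \<nu> (\<phi> s ` R \<inter> R') \<noteq> 0)}"

definition vertex_boundary :: "'v set \<Rightarrow> ('v \<times> 'v) set \<Rightarrow> 'v set \<Rightarrow> 'v set" where
  "vertex_boundary V E W = {v \<in> V - W. \<exists>w\<in>W. (w, v) \<in> E}"

(* Cardinality with value \<infinity> on infinite sets: boundaries may be infinite. *)
definition ecard :: "'v set \<Rightarrow> ennreal" where
  "ecard A = (if finite A then of_nat (card A) else \<infinity>)"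

definition cheeger_constant :: "'v set \<Rightarrow> ('v \<times> 'v) set \<Rightarrow> ennreal" where
  "cheeger_constant V E =
     (INF W \<in> {W. W \<subseteq> V \<and> finite W \<and> W \<noteq> {} \<and> ecard W \<le> ecard V / 2}.
        ecard (vertex_boundary V E W) / ecard W)"

(* The edge relation is symmetric, so that it does define a non-oriented graph, whenever the
   action preserves null sets. For an action that does not, symmetry may fail. *)
lemma simplicial_graph_approx_edges:
  fixes G :: "('g, 'b) monoid_scheme" and \<phi> :: "'g \<Rightarrow> 'x::topological_space \<Rightarrow> 'x"
  assumes act: "continuous_action G \<phi>"
    and S: "S \<subseteq> carrier G" "\<And>s. s \<in> S \<Longrightarrow> inv\<^bsub>G\<^esub> s \<in> S"
    and borel: "sets \<nu> = sets borel" and P: "P \<subseteq> sets \<nu>"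
    and null: "\<And>g A. g \<in> carrier G \<Longrightarrow> A \<in> sets \<nu> \<Longrightarrow> emeasure \<nu> A = 0 \<Longrightarrow> emeasure \<nu> (\<phi> g ` A) = 0"
  shows "simplicial_graph P (approx_edges \<nu> \<phi> S P)"
proof -
  interpret group_action G UNIV \<phi>
    using act by (simp add: continuous_action_def)
  interpret group G
    using group_hom by (simp add: group_hom_def)
  have inv: "\<phi> (inv\<^bsub>G\<^esub> g) (\<phi> g x) = x" "\<phi> g (\<phi> (inv\<^bsub>G\<^esub> g) x) = x" if "g \<in> carrier G" for g x
    using that orbit_sym_aux[of g x "\<phi> g x"] orbit_sym_aux[of "inv\<^bsub>G\<^esub> g" x "\<phi> (inv\<^bsub>G\<^esub> g) x"]
    by auto
  have meas: "\<phi> g -` A \<in> sets \<nu>" if "g \<in> carrier G" "A \<in> sets \<nu>" for g A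
  proof -
    have "continuous_on UNIV (\<phi> g)"
      using act that by (auto simp: continuous_action_def dest!: homeomorphic_imp_continuous_map)
    then have "\<phi> g \<in> borel_measurable borel"
      by (rule borel_measurable_continuous_onI)
    then show ?thesis
      using that measurable_sets[of "\<phi> g" borel borel A] by (simp add: borel)
  qed
  have "(R', R) \<in> approx_edges \<nu> \<phi> S P" if RR': "(R, R') \<in> approx_edges \<nu> \<phi> S P" for R R'
  proof -
    from RR' obtain s where s: "s \<in> S" "emeasure \<nu> (\<phi> s ` R \<inter> R') \<noteq> 0"
      and R: "R \<in> P" "R' \<in> P" "R \<noteq> R'"
      by (auto simp: approx_edges_def)
    have sG: "s \<in> carrier G"
      using s S by auto
    let ?t = "inv\<^bsub>G\<^esub> s"
    have eq: "\<phi> ?t ` R' = \<phi> s -` R'"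
    proof (intro Set.set_eqI iffI)
      fix x assume "x \<in> \<phi> s -` R'"
      then show "x \<in> \<phi> ?t ` R'"
        using inv(1)[OF sG, of x] by (metis image_eqI vimageD)
    qed (use inv(2)[OF sG] in auto)
    have "\<phi> ?t ` R' \<inter> R \<in> sets \<nu>"
      unfolding eq using meas[OF sG, of R'] R P by (intro sets.Int) auto
    moreover have "\<phi> s ` (\<phi> ?t ` R' \<inter> R) = \<phi> s ` R \<inter> R'"
      unfolding eq by auto
    ultimately have "emeasure \<nu> (\<phi> ?t ` R' \<inter> R) \<noteq> 0"
      using null[OF sG, of "\<phi> ?t ` R' \<inter> R"] s(2) by auto
    moreover have "?t \<in> S"
      using s(1) by (rule S(2))
    ultimately show ?thesis
      unfolding approx_edges_def using R by blast
  qed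
  then have "sym (approx_edges \<nu> \<phi> S P)"
    by (rule symI)
  moreover have "approx_edges \<nu> \<phi> S P \<subseteq> P \<times> P" "irrefl (approx_edges \<nu> \<phi> S P)"
    by (auto simp: approx_edges_def irrefl_def)
  ultimately show ?thesis
    by (simp add: simplicial_graph_def)
qed

end

theory Submission
  imports Defs
begin

text \<open>
  As all regions of a partition have comparable measure, the cardinality of a set of regions is
  comparable to the measure of its union, and S moves the union of W, up to a null set, into the
  union of W and its boundary. Expansion in measure of unions of regions is thus vertex expansion
  of the graph. The two conditions of occupying at most one half (in measure and in cardinality)
  do not match; a set W that is small in one sense only is handled through the complement C of
  W and its boundary, because the boundary of C is contained in that of W.

  Conversely, expansion of general sets reduces to compact sets K by inner regularity. Let W
  consist of the regions of small diameter that meet K in positive measure. Up to small measure,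
  they cover K, are contained in a neighbourhood of K, and W together with its boundary is
  contained in a neighbourhood of S K. For this last point the hypothesis on large regions is
  applied to a compact neighbourhood of S K, since the boundary regions need not meet S K.
\<close>

section \<open>Cardinalities and vertex boundaries\<close>

lemma ecard_eq_emeasure: "ecard A = emeasure (count_space A) A"
  by (simp add: ecard_def)

lemma ecard_finite: "finite A \<Longrightarrow> ecard A = ennreal (real (card A))"
  by (simp add: ecard_def ennreal_of_nat_eq_real_of_nat)

lemma ecard_le_half_iff:
  assumes "finite W" "finite V"
  shows "ecard W \<le> ecard V / 2 \<longleftrightarrow> 2 * card W \<le> card V"
proof -
  have "ecard V / 2 = ennreal (real (card V) / 2)"
    using assms divide_ennreal[of "real (card V)" 2] by (simp add: ecard_finite)
  then show ?thesis
    using assms by (simp add: ecard_finite) linarith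
qed

text \<open>A boundary vertex v of the complement has a neighbour w that lies neither in W nor in
  its boundary. If v were in W, symmetry of the edges would make w a neighbour of W. As v is also
  outside the complement, only the boundary of W remains.\<close>

lemma simplicial_boundary_complement:
  assumes "simplicial_graph V E" "W \<subseteq> V"
  shows "vertex_boundary V E (V - (W \<union> vertex_boundary V E W)) \<subseteq> vertex_boundary V E W"
proof
  fix v assume v: "v \<in> vertex_boundary V E (V - (W \<union> vertex_boundary V E W))"
  then obtain w where w: "w \<in> V" "w \<notin> W" "w \<notin> vertex_boundary V E W" "(w, v) \<in> E"
    by (auto simp: vertex_boundary_def)
  have "(v, w) \<in> E"
    using assms w by (auto simp: simplicial_graph_def dest: symD)
  then have "v \<notin> W"
    using w by (auto simp: vertex_boundary_def)
  with v show "v \<in> vertex_boundary V E W"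
    unfolding vertex_boundary_def[of V E "V - _"] by auto
qed

section \<open>Counting regions versus measuring their union\<close>

text \<open>The topology enters only through \<open>image_sets\<close>, and symmetry of the edges
  through \<open>graph\<close>. Everything inside compares counting with measuring on a plain
  measure space, for one partition at a time.\<close>

locale approx_partition =
  fixes \<nu> :: "'x measure" and \<phi> :: "'g \<Rightarrow> 'x \<Rightarrow> 'x" and S :: "'g set"
    and P :: "'x set set" and Q :: real
  assumes finite_S: "finite S"
    and image_sets: "\<And>s A. s \<in> S \<Longrightarrow> A \<in> sets \<nu> \<Longrightarrow> \<phi> s ` A \<in> sets \<nu>"
    and partition: "measurable_partition \<nu> P"
    and Q: "1 \<le> Q" and ratios: "measure_ratios_bounded \<nu> Q P"
    and graph: "simplicial_graph P (approx_edges \<nu> \<phi> S P)"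
begin

abbreviation bdry :: "'x set set \<Rightarrow> 'x set set" where
  "bdry \<equiv> vertex_boundary P (approx_edges \<nu> \<phi> S P)"

lemma bdry_subset: "bdry W \<subseteq> P" and bdry_disjoint: "W \<inter> bdry W = {}"
  by (auto simp: vertex_boundary_def)

lemma sets_region: "R \<in> P \<Longrightarrow> R \<in> sets \<nu>"
  and countable_regions: "W \<subseteq> P \<Longrightarrow> countable W"
  using partition by (auto simp: measurable_partition_def intro: countable_subset)

lemma sets_Union: "W \<subseteq> P \<Longrightarrow> \<Union>W \<in> sets \<nu>"
  using sets_region countable_regions by (intro sets.countable_Union) auto

lemma emeasure_Un:
  assumes "W \<subseteq> P" "W' \<subseteq> P" "W \<inter> W' = {}"
  shows "emeasure \<nu> (\<Union>(W \<union> W')) = emeasure \<nu> (\<Union>W) + emeasure \<nu> (\<Union>W')"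
proof -
  have "R \<inter> R' = {}" if "R \<in> W" "R' \<in> W'" for R R'
  proof -
    have "R \<noteq> R'" using that assms by auto
    then show ?thesis
      using that assms partition by (auto simp: measurable_partition_def dest: disjointD)
  qed
  then have "\<Union>W \<inter> \<Union>W' = {}"
    by blast
  then show ?thesis
    using assms by (simp add: plus_emeasure sets_Union)
qed

lemma AE_in_partition: "AE x in \<nu>. x \<in> \<Union>P"
  using partition by (intro AE_I[of _ _ "space \<nu> - \<Union>P"]) (auto simp: measurable_partition_def sets_Union)

lemma emeasure_partition: "emeasure \<nu> (\<Union>P) = emeasure \<nu> (space \<nu>)"
  using AE_in_partition by (intro emeasure_eq_AE) (auto simp: sets_Union)

text \<open>Compared with a fixed region of measure m, every region has measure between m / Q and Q
  m, so a = m / Q serves for both bounds at the price of a factor Q^2. Countable additivity is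
  written as an integral over \<open>count_space W\<close>, which also covers infinite W.\<close>

lemma region_bounds:
  assumes "P \<noteq> {}"
  obtains a :: real where "a > 0"
    "\<And>W. W \<subseteq> P \<Longrightarrow> ennreal a * ecard W \<le> emeasure \<nu> (\<Union>W)"
    "\<And>W. W \<subseteq> P \<Longrightarrow> emeasure \<nu> (\<Union>W) \<le> ennreal (Q\<^sup>2 * a) * ecard W"
proof -
  obtain R0 where R0: "R0 \<in> P"
    using assms by auto
  define m where "m = measure \<nu> R0"
  have fin: "emeasure \<nu> R = ennreal (measure \<nu> R)" if "R \<in> P" for R
    using that ratios by (auto simp: measure_ratios_bounded_def less_top emeasure_eq_ennreal_measure)
  have ratio: "1 / Q \<le> measure \<nu> R / m" "measure \<nu> R / m \<le> Q" if "R \<in> P" for R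
    using that ratios R0 by (auto simp: measure_ratios_bounded_def m_def)
  \<comment> \<open>If m were 0, the quotient of the reference region by itself would be 0 by the
    convention on division, contrary to the lower bound 1 / Q.\<close>
  have m: "m > 0"
  proof (rule ccontr)
    assume "\<not> m > 0"
    then have "m = 0" by (simp add: m_def less_le)
    then show False using ratio(1)[OF R0] Q by simp
  qed
  have bnd: "m / Q \<le> measure \<nu> R" "measure \<nu> R \<le> Q\<^sup>2 * (m / Q)" if "R \<in> P" for R
    using ratio[OF that] m Q by (auto simp: field_simps power2_eq_square)
  have U: "emeasure \<nu> (\<Union>W) = (\<integral>\<^sup>+R. emeasure \<nu> R \<partial>count_space W)" if "W \<subseteq> P" for W
  proof -
    have "disjoint W"
      using that partition by (auto simp: measurable_partition_def intro: pairwise_subset)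
    then have "disjoint_family_on (\<lambda>R. R) W"
      by (simp add: disjoint_family_on_def pairwise_def disjnt_def)
    then have "emeasure \<nu> (\<Union>R\<in>W. R) = (\<integral>\<^sup>+R. emeasure \<nu> R \<partial>count_space W)"
      using that sets_region countable_regions by (intro emeasure_UN_countable) auto
    then show ?thesis by simp
  qed
  show ?thesis
  proof
    show "m / Q > 0" using m Q by simp
    fix W assume W: "W \<subseteq> P"
    have "ennreal (m / Q) * ecard W = (\<integral>\<^sup>+R. ennreal (m / Q) \<partial>count_space W)"
      by (simp add: ecard_eq_emeasure)
    also have "\<dots> \<le> emeasure \<nu> (\<Union>W)"
      unfolding U[OF W] using W fin bnd by (intro nn_integral_mono) (auto intro: ennreal_leI)
    finally show "ennreal (m / Q) * ecard W \<le> emeasure \<nu> (\<Union>W)" .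
    have "emeasure \<nu> (\<Union>W) \<le> (\<integral>\<^sup>+R. ennreal (Q\<^sup>2 * (m / Q)) \<partial>count_space W)"
      unfolding U[OF W]
    proof (rule nn_integral_mono)
      fix R assume "R \<in> space (count_space W)"
      then have "R \<in> P" using W by auto
      then show "emeasure \<nu> R \<le> ennreal (Q\<^sup>2 * (m / Q))"
        unfolding fin[OF \<open>R \<in> P\<close>] by (intro ennreal_leI bnd(2))
    qed
    also have "\<dots> = ennreal (Q\<^sup>2 * (m / Q)) * ecard W"
      by (simp add: ecard_eq_emeasure)
    finally show "emeasure \<nu> (\<Union>W) \<le> ennreal (Q\<^sup>2 * (m / Q)) * ecard W" .
  qed
qed

lemma emeasure_finite_regions:
  assumes "W \<subseteq> P" "finite W"
  shows "emeasure \<nu> (\<Union>W) < \<infinity>"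
proof (cases "P = {}")
  case False
  then obtain a where a: "a > 0" "\<And>W. W \<subseteq> P \<Longrightarrow> emeasure \<nu> (\<Union>W) \<le> ennreal (Q\<^sup>2 * a) * ecard W"
    by (rule region_bounds) blast
  have "ennreal (Q\<^sup>2 * a) * ecard W < \<infinity>"
    using assms(2) by (simp add: ecard_finite ennreal_mult_less_top)
  then show ?thesis
    using a(2)[OF assms(1)] by (rule le_less_trans[rotated])
qed (use assms in auto)

text \<open>The measures of the regions are bounded away from 0, so infinitely many regions have a
  union of infinite measure.\<close>

lemma finite_regions:
  assumes "W \<subseteq> P" "emeasure \<nu> (\<Union>W) < \<infinity>"
  shows "finite W"
proof (rule ccontr)
  assume inf: "infinite W"
  then have "P \<noteq> {}" using assms by auto
  then obtain a where a: "a > 0" "\<And>W. W \<subseteq> P \<Longrightarrow> ennreal a * ecard W \<le> emeasure \<nu> (\<Union>W)"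
    by (rule region_bounds) blast
  then show False
    using a(2)[OF assms(1)] a(1) assms(2) inf by (simp add: ecard_def ennreal_mult_top)
qed

text \<open>For fixed s, R and R', a null intersection of s R with R' can be discarded, and there
  are only countably many such triples. Almost every remaining point of s R lies in a region R' that
  meets s R in positive measure, that is, in R itself or in a neighbour of R.\<close>

lemma emeasure_act_set_le:
  assumes "W \<subseteq> P"
  shows "emeasure \<nu> (act_set \<phi> S (\<Union>W)) \<le> emeasure \<nu> (\<Union>(W \<union> bdry W))"
proof (rule emeasure_mono_AE)
  let ?N = "\<lambda>s R R'. emeasure \<nu> (\<phi> s ` R \<inter> R') = 0"
  have "AE x in \<nu>. \<forall>s\<in>S. \<forall>R\<in>W. \<forall>R'\<in>P. ?N s R R' \<longrightarrow> x \<notin> \<phi> s ` R \<inter> R'"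
  proof -
    have "AE x in \<nu>. ?N s R R' \<longrightarrow> x \<notin> \<phi> s ` R \<inter> R'" if "s \<in> S" "R \<in> W" "R' \<in> P" for s R R'
    proof (cases "?N s R R'")
      case True
      then show ?thesis
        using that assms
        by (intro AE_I[of _ _ "\<phi> s ` R \<inter> R'"] sets.Int image_sets) (auto intro: sets_region)
    qed auto
    then show ?thesis
      using assms finite_S countable_regions
      by (auto simp: AE_ball_countable countable_finite)
  qed
  then show "AE x in \<nu>. x \<in> act_set \<phi> S (\<Union>W) \<longrightarrow> x \<in> \<Union>(W \<union> bdry W)"
    using AE_in_partition
  proof eventually_elim
    case (elim x)
    show ?case
    proof
      assume "x \<in> act_set \<phi> S (\<Union>W)"
      then obtain s R where s: "s \<in> S" "R \<in> W" "x \<in> \<phi> s ` R"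
        by (auto simp: act_set_def)
      obtain R' where R': "R' \<in> P" "x \<in> R'"
        using elim by auto
      then have "\<not> ?N s R R'"
        using elim s by blast
      then have "R' \<in> W \<or> R' \<in> bdry W"
        using s R' assms by (auto simp: vertex_boundary_def approx_edges_def)
      then show "x \<in> \<Union>(W \<union> bdry W)"
        using R' by auto
    qed
  qed
qed (use assms bdry_subset in \<open>auto intro!: sets_Union\<close>)

section \<open>From expansion in measure to a Cheeger bound\<close>

text \<open>Expansion of the union of W, bounded above by \<open>emeasure_act_set_le\<close>, leaves
  \<alpha> times its measure for the boundary once the finite measure of the union is cancelled.
  Passing to cardinalities costs the factor Q^2.\<close>

lemma boundary_of_expanding:
  assumes \<alpha>: "\<alpha> > 0"
    and exp: "\<And>A. A \<in> sets \<nu> \<Longrightarrow> emeasure \<nu> A < \<infinity> \<Longrightarrow> emeasure \<nu> A \<le> emeasure \<nu> (space \<nu>) / 2 \<Longrightarrow>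
                ennreal (1 + \<alpha>) * emeasure \<nu> A \<le> emeasure \<nu> (act_set \<phi> S A)"
    and W: "W \<subseteq> P" "finite W" "emeasure \<nu> (\<Union>W) \<le> emeasure \<nu> (space \<nu>) / 2"
  shows "ennreal \<alpha> * ecard W \<le> ennreal (Q\<^sup>2) * ecard (bdry W)"
proof (cases "P = {}")
  case True
  then show ?thesis using W by (simp add: ecard_def)
next
  case False
  then obtain a where a: "a > 0"
    "\<And>W. W \<subseteq> P \<Longrightarrow> ennreal a * ecard W \<le> emeasure \<nu> (\<Union>W)"
    "\<And>W. W \<subseteq> P \<Longrightarrow> emeasure \<nu> (\<Union>W) \<le> ennreal (Q\<^sup>2 * a) * ecard W"
    by (rule region_bounds) blast
  have fin: "emeasure \<nu> (\<Union>W) < \<infinity>"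
    using W by (intro emeasure_finite_regions)
  have "emeasure \<nu> (\<Union>W) + ennreal \<alpha> * emeasure \<nu> (\<Union>W) = ennreal (1 + \<alpha>) * emeasure \<nu> (\<Union>W)"
    using \<alpha> by (simp add: distrib_right)
  also have "\<dots> \<le> emeasure \<nu> (act_set \<phi> S (\<Union>W))"
    using W fin sets_Union by (intro exp)
  also have "\<dots> \<le> emeasure \<nu> (\<Union>(W \<union> bdry W))"
    using W by (intro emeasure_act_set_le)
  also have "\<dots> = emeasure \<nu> (\<Union>W) + emeasure \<nu> (\<Union>(bdry W))"
    using W bdry_subset bdry_disjoint by (intro emeasure_Un)
  finally have *: "ennreal \<alpha> * emeasure \<nu> (\<Union>W) \<le> emeasure \<nu> (\<Union>(bdry W))"
    using fin by (auto simp: ennreal_add_left_cancel_le)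
  \<comment> \<open>The factor a is carried through the chain because \<open>region_bounds\<close>
    has it on both sides; it is cancelled at the end.\<close>
  have "ennreal a * (ennreal \<alpha> * ecard W) = ennreal \<alpha> * (ennreal a * ecard W)"
    by (simp add: mult_ac)
  also have "\<dots> \<le> ennreal \<alpha> * emeasure \<nu> (\<Union>W)"
    using a W by (intro mult_left_mono) auto
  also note *
  also have "emeasure \<nu> (\<Union>(bdry W)) \<le> ennreal (Q\<^sup>2 * a) * ecard (bdry W)"
    using a(3) bdry_subset .
  also have "\<dots> = ennreal a * (ennreal (Q\<^sup>2) * ecard (bdry W))"
    using a(1) by (simp add: ennreal_mult mult_ac)
  finally show ?thesis
    using a(1) by (subst (asm) ennreal_mult_le_mult_iff) auto
qed

lemma card_complement:
  assumes "finite P" "W \<subseteq> P"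
  shows "card W + card (bdry W) + card (P - (W \<union> bdry W)) = card P"
proof -
  have "card (W \<union> bdry W) = card W + card (bdry W)"
    using assms bdry_subset bdry_disjoint by (intro card_Un_disjoint) (auto intro: finite_subset)
  moreover have "card (P - (W \<union> bdry W)) + card (W \<union> bdry W) = card P"
    using assms bdry_subset card_Diff_subset[of "W \<union> bdry W" P] card_mono[of P "W \<union> bdry W"]
    by (metis Un_least finite_subset le_add_diff_inverse2)
  ultimately show ?thesis by linarith
qed

lemma card_bdry_complement:
  assumes "finite P" "W \<subseteq> P"
  shows "card (bdry (P - (W \<union> bdry W))) \<le> card (bdry W)"
  using assms graph bdry_subset
  by (intro card_mono simplicial_boundary_complement) (auto intro: finite_subset)

text \<open>The summand \<alpha> in the denominator pays for sets W with few regions but more than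
  half of the measure. For these the complement C expands, and |W| is at most |C| plus the size of
  the boundary of W.\<close>

lemma cheeger_of_expanding:
  assumes \<alpha>: "\<alpha> > 0"
    and exp: "\<And>A. A \<in> sets \<nu> \<Longrightarrow> emeasure \<nu> A < \<infinity> \<Longrightarrow> emeasure \<nu> A \<le> emeasure \<nu> (space \<nu>) / 2 \<Longrightarrow>
                ennreal (1 + \<alpha>) * emeasure \<nu> A \<le> emeasure \<nu> (act_set \<phi> S A)"
  shows "ennreal (\<alpha> / (\<alpha> + Q\<^sup>2)) \<le> cheeger_constant P (approx_edges \<nu> \<phi> S P)"
  unfolding cheeger_constant_def
proof (rule INF_greatest, clarify)
  fix W assume W: "W \<subseteq> P" "finite W" "W \<noteq> {}" "ecard W \<le> ecard P / 2"
  have cW: "card W > 0" using W by (simp add: card_gt_0_iff)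
  have Q2: "Q\<^sup>2 > 0" using Q by simp
  show "ennreal (\<alpha> / (\<alpha> + Q\<^sup>2)) \<le> ecard (bdry W) / ecard W"
  \<comment> \<open>Degrees may be infinite; an infinite boundary makes the quotient
    infinite.\<close>
  proof (cases "finite (bdry W)")
    case False
    then show ?thesis
      using W by (simp add: ecard_def ennreal_top_divide)
  next
    case fin: True
    have key: "\<alpha> * card W \<le> (\<alpha> + Q\<^sup>2) * card (bdry W)"
    proof (cases "emeasure \<nu> (\<Union>W) \<le> emeasure \<nu> (space \<nu>) / 2")
      case True
      from boundary_of_expanding[OF \<alpha> exp W(1,2) True]
      have "\<alpha> * card W \<le> Q\<^sup>2 * card (bdry W)"
        using fin W \<alpha> by (simp add: ecard_finite flip: ennreal_mult)
      also have "\<dots> \<le> (\<alpha> + Q\<^sup>2) * card (bdry W)"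
        using \<alpha> by (intro mult_right_mono) auto
      finally show ?thesis .
    next
      case False
      define C where "C = P - (W \<union> bdry W)"
      \<comment> \<open>Exceeding half of the total measure forces the total to be finite, because
        half of infinity is infinity. Then there are only finitely many regions.\<close>
      have sp: "emeasure \<nu> (space \<nu>) < \<infinity>"
        using False by (cases "emeasure \<nu> (space \<nu>)") (auto simp: ennreal_top_divide)
      have finP: "finite P"
        using sp by (intro finite_regions) (auto simp: emeasure_partition)
      have C: "C \<subseteq> P" "finite C" using finP by (auto simp: C_def)
      have "emeasure \<nu> (\<Union>C) + emeasure \<nu> (\<Union>W) = emeasure \<nu> (\<Union>(C \<union> W))"
        using C W by (intro emeasure_Un[symmetric]) (auto simp: C_def)
      also have "\<dots> \<le> emeasure \<nu> (space \<nu>)"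
        by (rule emeasure_space)
      finally have "emeasure \<nu> (\<Union>C) \<le> emeasure \<nu> (space \<nu>) / 2"
      proof -
        assume le: "emeasure \<nu> (\<Union>C) + emeasure \<nu> (\<Union>W) \<le> emeasure \<nu> (space \<nu>)"
        obtain m where m: "m \<ge> 0" "emeasure \<nu> (space \<nu>) = ennreal m"
          using sp by (cases "emeasure \<nu> (space \<nu>)") auto
        obtain c where c: "c \<ge> 0" "emeasure \<nu> (\<Union>C) = ennreal c"
          using emeasure_finite_regions[OF C] by (cases "emeasure \<nu> (\<Union>C)") auto
        obtain w where w: "w \<ge> 0" "emeasure \<nu> (\<Union>W) = ennreal w"
          using emeasure_finite_regions[OF W(1,2)] by (cases "emeasure \<nu> (\<Union>W)") auto
        have half: "ennreal m / 2 = ennreal (m / 2)"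
          using divide_ennreal[of m 2] m by simp
        show ?thesis
          using le False m c w by (auto simp: half ennreal_less_iff not_le simp flip: ennreal_plus)
      qed
      from boundary_of_expanding[OF \<alpha> exp C this]
      have "\<alpha> * card C \<le> Q\<^sup>2 * card (bdry C)"
        using finite_subset[OF bdry_subset finP] C \<alpha>
        by (simp add: ecard_finite flip: ennreal_mult)
      also have "\<dots> \<le> Q\<^sup>2 * card (bdry W)"
        using card_bdry_complement[OF finP W(1)] by (intro mult_left_mono) (auto simp: C_def)
      finally have C': "\<alpha> * card C \<le> Q\<^sup>2 * card (bdry W)" .
      have "2 * card W \<le> card P"
        using W finP by (simp add: ecard_le_half_iff)
      \<comment> \<open>|W| is at most |P| - |W|, which is the size of the boundary plus
        |C|.\<close>
      then have "real (card W) \<le> card (bdry W) + card C"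
        using card_complement[OF finP W(1)] unfolding C_def by linarith
      then have "\<alpha> * card W \<le> \<alpha> * (card (bdry W) + card C)"
        using \<alpha> by (intro mult_left_mono) auto
      with C' show ?thesis
        by (simp add: algebra_simps)
    qed
    have "\<alpha> / (\<alpha> + Q\<^sup>2) \<le> card (bdry W) / card W"
      using key cW \<alpha> Q2 by (simp add: field_simps add_pos_pos)
    then have "ennreal (\<alpha> / (\<alpha> + Q\<^sup>2)) \<le> ennreal (card (bdry W) / card W)"
      by (rule ennreal_leI)
    also have "\<dots> = ecard (bdry W) / ecard W"
      using fin W cW by (simp add: ecard_finite divide_ennreal)
    finally show ?thesis .
  qed
qed

section \<open>From a Cheeger bound to the measure of boundaries\<close>

lemma cheeger_bound:
  assumes \<epsilon>: "\<epsilon> > 0" and h: "ennreal \<epsilon> \<le> cheeger_constant P (approx_edges \<nu> \<phi> S P)"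
    and W: "W \<subseteq> P" "finite W" "ecard W \<le> ecard P / 2"
  shows "ennreal \<epsilon> * ecard W \<le> ecard (bdry W)"
proof (cases "W = {}")
  case False
  then have "ecard W \<noteq> 0" "ecard W < \<infinity>"
    using W by (auto simp: ecard_finite)
  have "ennreal \<epsilon> \<le> ecard (bdry W) / ecard W"
    by (rule order_trans[OF h]) (use W False in \<open>auto simp: cheeger_constant_def intro!: INF_lower\<close>)
  then have "ennreal \<epsilon> * ecard W \<le> ecard (bdry W) / ecard W * ecard W"
    by (intro mult_right_mono) auto
  also have "\<dots> = ecard (bdry W)"
    using \<open>ecard W \<noteq> 0\<close> \<open>ecard W < \<infinity>\<close> by (simp add: ennreal_divide_times)
  finally show ?thesis .
qed (simp add: ecard_def)

text \<open>The minimum replaces the condition on one half, so that the estimate can be applied to a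
  W about whose cardinality nothing is known. If W has more than half of the regions, C has at most
  half and satisfies the Cheeger bound. Adding the boundary to C gives P - W and turns \<epsilon>
  into \<epsilon> / (1 + \<epsilon>).\<close>

lemma boundary_of_cheeger:
  assumes \<epsilon>: "\<epsilon> > 0" and h: "ennreal \<epsilon> \<le> cheeger_constant P (approx_edges \<nu> \<phi> S P)"
    and W: "W \<subseteq> P" "finite W"
  shows "ennreal (\<epsilon> / ((1 + \<epsilon>) * Q\<^sup>2)) * min (emeasure \<nu> (\<Union>W)) (emeasure \<nu> (\<Union>(P - W)))
           \<le> emeasure \<nu> (\<Union>(bdry W))"
proof (cases "P = {}")
  case True
  then show ?thesis using W by simp
next
  case False
  then obtain a where a: "a > 0"
    "\<And>W. W \<subseteq> P \<Longrightarrow> ennreal a * ecard W \<le> emeasure \<nu> (\<Union>W)"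
    "\<And>W. W \<subseteq> P \<Longrightarrow> emeasure \<nu> (\<Union>W) \<le> ennreal (Q\<^sup>2 * a) * ecard W"
    by (rule region_bounds) blast
  have Q2: "Q\<^sup>2 > 0" using Q by simp
  \<comment> \<open>Both cases below end in the same estimate of cardinalities, for W or for P - W;
    its conversion to measures is done once here and brings in Q^2.\<close>
  have *: ?thesis if W': "W' \<in> {W, P - W}" and le: "ennreal (\<epsilon> / (1 + \<epsilon>)) * ecard W' \<le> ecard (bdry W)" for W'
  proof -
    have "ennreal (\<epsilon> / ((1 + \<epsilon>) * Q\<^sup>2)) * min (emeasure \<nu> (\<Union>W)) (emeasure \<nu> (\<Union>(P - W)))
      \<le> ennreal (\<epsilon> / ((1 + \<epsilon>) * Q\<^sup>2)) * emeasure \<nu> (\<Union>W')"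
      using W' by (intro mult_left_mono) auto
    also have "\<dots> \<le> ennreal (\<epsilon> / ((1 + \<epsilon>) * Q\<^sup>2)) * (ennreal (Q\<^sup>2 * a) * ecard W')"
      using W' W by (intro mult_left_mono a(3)) auto
    also have "\<dots> = ennreal (\<epsilon> / ((1 + \<epsilon>) * Q\<^sup>2) * (Q\<^sup>2 * a)) * ecard W'"
      using a(1) \<epsilon> by (subst (2) ennreal_mult) (auto simp: mult.assoc)
    also have "\<epsilon> / ((1 + \<epsilon>) * Q\<^sup>2) * (Q\<^sup>2 * a) = a * (\<epsilon> / (1 + \<epsilon>))"
      using Q2 by simp
    also have "ennreal \<dots> * ecard W' = ennreal a * (ennreal (\<epsilon> / (1 + \<epsilon>)) * ecard W')"
      using a(1) \<epsilon> by (subst ennreal_mult) (auto simp: mult.assoc)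
    also have "\<dots> \<le> ennreal a * ecard (bdry W)"
      using le by (intro mult_left_mono) auto
    also have "\<dots> \<le> emeasure \<nu> (\<Union>(bdry W))"
      using bdry_subset by (rule a(2))
    finally show ?thesis .
  qed
  show ?thesis
  proof (cases "ecard W \<le> ecard P / 2")
    case True
    have "ennreal (\<epsilon> / (1 + \<epsilon>)) * ecard W \<le> ennreal \<epsilon> * ecard W"
      using \<epsilon> by (intro mult_right_mono ennreal_leI) (auto simp: field_simps)
    also have "\<dots> \<le> ecard (bdry W)"
      using cheeger_bound[OF \<epsilon> h W True] .
    finally show ?thesis by (rule *[rotated]) simp
  next
    case False
    \<comment> \<open>For infinite P the bound \<open>ecard P / 2\<close> would be infinite and
      could not be exceeded.\<close>
    have finP: "finite P"
      using False by (rule contrapos_np) (simp add: ecard_def ennreal_top_divide)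
    define C where "C = P - (W \<union> bdry W)"
    have C: "C \<subseteq> P" "finite C" using finP by (auto simp: C_def)
    have eq: "card W + card (bdry W) + card C = card P"
      unfolding C_def using finP W by (intro card_complement)
    have "ecard C \<le> ecard P / 2"
      using False eq finP C W by (simp add: ecard_le_half_iff)
    from cheeger_bound[OF \<epsilon> h C this] have "\<epsilon> * card C \<le> card (bdry C)"
      using \<epsilon> C finite_subset[OF bdry_subset finP] by (simp add: ecard_finite flip: ennreal_mult)
    also have "\<dots> \<le> card (bdry W)"
      using card_bdry_complement[OF finP W(1)] by (simp add: C_def)
    finally have 1: "\<epsilon> * card C \<le> card (bdry W)" .
    have "card (P - W) = card (bdry W) + card C"
      using eq W by (simp add: card_Diff_subset)
    then have "\<epsilon> * card (P - W) \<le> (1 + \<epsilon>) * card (bdry W)"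
      using 1 by (simp add: algebra_simps)
    then have "\<epsilon> / (1 + \<epsilon>) * card (P - W) \<le> card (bdry W)"
      using \<epsilon> by (simp add: field_simps)
    then have "ennreal (\<epsilon> / (1 + \<epsilon>)) * ecard (P - W) \<le> ecard (bdry W)"
      using \<epsilon> finP finite_subset[OF bdry_subset finP] by (simp add: ecard_finite flip: ennreal_mult)
    then show ?thesis by (rule *[rotated]) simp
  qed
qed

end

section \<open>Compact sets and Radon measures\<close>

lemma compact_neighbourhood:
  fixes K :: "'x::metric_space set"
  assumes "locally_compact_space (euclidean :: 'x topology)" "compact K"
  obtains U C where "open U" "compact C" "K \<subseteq> U" "U \<subseteq> C"
proof -
  have "Hausdorff_space (euclidean :: 'x topology) \<or> regular_space (euclidean :: 'x topology)"
    by (simp add: Hausdorff_space_euclidean)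
  from locally_compact_space_compact_closed_compact[OF this] assms
  obtain U C where "openin euclidean U" "compactin euclidean C" "K \<subseteq> U" "U \<subseteq> C"
    by (metis compactin_euclidean_iff)
  then show ?thesis
    by (intro that[of U C]) auto
qed

lemma radon_measure_compact_finite:
  fixes K :: "'x::topological_space set"
  assumes "radon_measure \<nu>" "compact K"
  shows "emeasure \<nu> K < \<infinity>"
proof -
  have sets: "sets \<nu> = sets borel"
    using assms by (simp add: radon_measure_def)
  obtain U where U: "\<And>x. open (U x)" "\<And>x. x \<in> U x" "\<And>x. emeasure \<nu> (U x) < \<infinity>"
    using assms(1) unfolding radon_measure_def by metis
  have "K \<subseteq> (\<Union>x\<in>K. U x)"
    using U(2) by auto
  from compactE_image[OF assms(2) U(1) this]
  obtain D where D: "D \<subseteq> K" "finite D" "K \<subseteq> (\<Union>x\<in>D. U x)"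
    by auto
  have "emeasure \<nu> K \<le> emeasure \<nu> (\<Union>x\<in>D. U x)"
    using D U(1) by (intro emeasure_mono) (auto simp: sets)
  also have "\<dots> \<le> (\<Sum>x\<in>D. emeasure \<nu> (U x))"
    using D U(1) by (intro emeasure_subadditive_finite) (auto simp: sets)
  also have "\<dots> < \<infinity>"
    using D U(3) by simp
  finally show ?thesis .
qed

text \<open>Inner regularity yields outer approximation inside an open O' of finite measure: a
  compact F exhausting O' - L up to \<eta> is removed from O'. The compact C around U is kept
  because the hypothesis on large regions speaks of compact sets.\<close>

lemma radon_measure_outer_approx:
  fixes L :: "'x::metric_space set"
  assumes radon: "radon_measure \<nu>" and lc: "locally_compact_space (euclidean :: 'x topology)"
    and L: "compact L" and \<eta>: "\<eta> > 0"
  obtains U C where "open U" "compact C" "L \<subseteq> U" "U \<subseteq> C"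
    "emeasure \<nu> U \<le> emeasure \<nu> L + ennreal \<eta>"
proof -
  have sets: "sets \<nu> = sets borel"
    using radon by (simp add: radon_measure_def)
  obtain O' C where O': "open O'" "compact C" "L \<subseteq> O'" "O' \<subseteq> C"
    using compact_neighbourhood[OF lc L] .
  have bL: "L \<in> sets \<nu>" and bO: "O' \<in> sets \<nu>" and bC: "C \<in> sets \<nu>"
    using L O' by (auto simp: sets intro: borel_compact)
  have "emeasure \<nu> O' \<le> emeasure \<nu> C"
    using O' bC by (intro emeasure_mono)
  also have "\<dots> < \<infinity>"
    using radon O'(2) by (rule radon_measure_compact_finite)
  finally have finO: "emeasure \<nu> O' < \<infinity>" .
  have finD: "emeasure \<nu> (O' - L) < \<infinity>"
    using finO bO by (intro le_less_trans[OF emeasure_mono[of "O' - L" O']]) auto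
  have sup: "emeasure \<nu> (O' - L) = (SUP K \<in> {K. compact K \<and> K \<subseteq> O' - L}. emeasure \<nu> K)"
    using radon bO bL by (auto simp: radon_measure_def)
  obtain F where F: "compact F" "F \<subseteq> O' - L" "emeasure \<nu> (O' - L) \<le> emeasure \<nu> F + ennreal \<eta>"
  \<comment> \<open>Subtracting \<eta> lowers the value strictly only if it is not 0, and the
    supremum yields F only from a strict inequality.\<close>
  proof (cases "emeasure \<nu> (O' - L) = 0")
    case True
    then show ?thesis by (intro that[of "{}"]) auto
  next
    case False
    have "emeasure \<nu> (O' - L) - ennreal \<eta> < emeasure \<nu> (O' - L)"
      using finD False \<eta> by (intro ennreal_between) (auto simp: zero_less_iff_neq_zero)
    then obtain F where F: "compact F" "F \<subseteq> O' - L" "emeasure \<nu> (O' - L) - ennreal \<eta> < emeasure \<nu> F"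
      unfolding sup less_SUP_iff by auto
    then show ?thesis
      by (intro that[of F]) (auto simp: ennreal_minus_le_iff add.commute dest: less_imp_le)
  qed
  have bF: "F \<in> sets \<nu>"
    using F by (auto simp: sets intro: borel_compact)
  have "emeasure \<nu> F \<le> emeasure \<nu> (O' - L)"
    using F bO bL by (intro emeasure_mono) auto
  then have finF: "emeasure \<nu> F < \<infinity>"
    using finD by (rule le_less_trans)
  have "emeasure \<nu> (O' - F) + emeasure \<nu> F = emeasure \<nu> O'"
    using F bO bF by (subst plus_emeasure) (auto intro!: arg_cong[where f = "emeasure \<nu>"])
  also have "\<dots> = emeasure \<nu> L + emeasure \<nu> (O' - L)"
    using O' bO bL by (subst plus_emeasure) (auto intro!: arg_cong[where f = "emeasure \<nu>"])
  also have "\<dots> \<le> emeasure \<nu> L + (emeasure \<nu> F + ennreal \<eta>)"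
    using F by (intro add_left_mono)
  finally have "emeasure \<nu> F + emeasure \<nu> (O' - F) \<le> emeasure \<nu> F + (emeasure \<nu> L + ennreal \<eta>)"
    by (simp add: ac_simps)
  then have "emeasure \<nu> (O' - F) \<le> emeasure \<nu> L + ennreal \<eta>"
    using finF by (auto simp: ennreal_add_left_cancel_le)
  then show ?thesis
    using F O' by (intro that[of "O' - F" C]) (auto intro!: open_Diff compact_imp_closed)
qed

section \<open>Expansion of compact sets\<close>

lemma ediam_dist_le:
  assumes "ediam R \<le> ennreal r" "x \<in> R" "y \<in> R" "r \<ge> 0"
  shows "dist x y \<le> r"
proof -
  have "ennreal (dist x y) \<le> ediam R"
    unfolding ediam_def
    by (rule SUP_upper2[OF assms(2)], rule SUP_upper2[OF assms(3)]) simp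
  also note assms(1)
  finally show ?thesis using assms(4) by simp
qed

lemma ennreal_double_le_if_le_half:
  fixes y :: ennreal
  assumes "ennreal k \<le> y / 2" "k \<ge> 0"
  shows "ennreal (2 * k) \<le> y"
proof (cases y)
  case (real r)
  then have "y / 2 = ennreal (r / 2)"
    using divide_ennreal[of r 2] by simp
  then show ?thesis
    using assms real by simp
qed simp

text \<open>This is the estimate for a single partition; all choices of neighbourhoods and limits
  are left to \<open>compact_expanding\<close>, where L is S K and k, l are the measures of K and L.
  It combines three bounds: W has measure at least k - \<eta>, W with its boundary has measure at
  most l + 2 \<eta>, and the boundary has a fixed proportion of k - \<eta>.\<close>

lemma expanding_up_to_error:
  fixes \<nu> :: "'x::metric_space measure"
  assumes "approx_partition \<nu> \<phi> S P Q"
    and \<epsilon>: "\<epsilon> > 0" and h: "ennreal \<epsilon> \<le> cheeger_constant P (approx_edges \<nu> \<phi> S P)"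
    and sets: "K \<in> sets \<nu>" "C \<in> sets \<nu>" "V \<in> sets \<nu>" "U \<in> sets \<nu>"
    and k: "emeasure \<nu> K = ennreal k" "k \<ge> 0" and half: "emeasure \<nu> K \<le> emeasure \<nu> (space \<nu>) / 2"
    and V: "(\<Union>x\<in>K. ball x \<rho>) \<subseteq> V" "emeasure \<nu> V \<le> ennreal (k + \<eta>)"
    and U: "(\<Union>x\<in>L. ball x (2 * \<delta>)) \<subseteq> U" "U \<subseteq> C" "emeasure \<nu> U \<le> ennreal (l + \<eta>)"
    and move: "\<And>s. s \<in> S \<Longrightarrow> \<phi> s ` (\<Union>x\<in>K. ball x \<rho>) \<subseteq> (\<Union>x\<in>L. ball x \<delta>)"
    and VU: "(\<Union>x\<in>K. ball x \<rho>) \<subseteq> U"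
    and r: "0 < r" "r < \<rho>" "emeasure \<nu> (large_regions \<nu> P K r) \<le> ennreal \<eta>"
    and r': "0 < r'" "r' < \<delta>" "emeasure \<nu> (large_regions \<nu> P C r') \<le> ennreal \<eta>"
    and l: "l \<ge> 0" and \<eta>: "\<eta> > 0"
  shows "(1 + \<epsilon> / ((1 + \<epsilon>) * Q\<^sup>2)) * (k - \<eta>) \<le> l + 2 * \<eta>"
proof -
  interpret approx_partition \<nu> \<phi> S P Q by fact
  define \<beta> where "\<beta> = \<epsilon> / ((1 + \<epsilon>) * Q\<^sup>2)"
  have \<beta>: "\<beta> \<ge> 0" using \<epsilon> by (simp add: \<beta>_def)
  define W where "W = {R \<in> P. emeasure \<nu> (R \<inter> K) > 0 \<and> ediam R \<le> ennreal r}"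
  have W: "W \<subseteq> P" by (auto simp: W_def)
  have large: "large_regions \<nu> P A t \<in> sets \<nu>" for A t
    unfolding large_regions_def by (rule sets_Union) auto
  have near: "R \<subseteq> (\<Union>x\<in>K. ball x \<rho>)" if "R \<in> W" for R
  proof
    fix y assume y: "y \<in> R"
    have "R \<inter> K \<noteq> {}" using that by (auto simp: W_def)
    then obtain x where x: "x \<in> R" "x \<in> K" by auto
    have "dist x y \<le> r"
      using that x y r by (intro ediam_dist_le[of R]) (auto simp: W_def)
    then show "y \<in> (\<Union>x\<in>K. ball x \<rho>)"
      using x r by (auto intro!: bexI[of _ x])
  qed
  have move': "\<phi> s ` R \<subseteq> (\<Union>x\<in>L. ball x \<delta>)" if "s \<in> S" "R \<in> W" for s R
    using image_mono[OF near[OF that(2)]] move[OF that(1)] by (rule order_trans)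
  \<comment> \<open>This upper bound makes W finite, and later it ensures that enough measure
    remains outside W.\<close>
  have "emeasure \<nu> (\<Union>W) \<le> emeasure \<nu> V"
    using near V sets by (intro emeasure_mono) blast+
  also note V(2)
  finally have W_le: "emeasure \<nu> (\<Union>W) \<le> ennreal (k + \<eta>)" .
  then have finW: "emeasure \<nu> (\<Union>W) < \<infinity>"
    by (rule le_less_trans) simp
  then have W_fin: "finite W"
    using W by (intro finite_regions)
  obtain w where w: "w \<ge> 0" "emeasure \<nu> (\<Union>W) = ennreal w"
    using finW by (cases "emeasure \<nu> (\<Union>W)") auto

  \<comment> \<open>Regions meeting K in a null set can be ignored, as there are countably many; the
    others are in W or large.\<close>
  have "emeasure \<nu> K \<le> emeasure \<nu> (\<Union>W \<union> large_regions \<nu> P K r)"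
  proof (rule emeasure_mono_AE)
    have "AE x in \<nu>. emeasure \<nu> (R \<inter> K) = 0 \<longrightarrow> x \<notin> R \<inter> K" if "R \<in> P" for R
    proof (cases "emeasure \<nu> (R \<inter> K) = 0")
      case True
      then show ?thesis
        using that sets sets_region by (intro AE_I[of _ _ "R \<inter> K"]) auto
    qed auto
    then have "AE x in \<nu>. \<forall>R\<in>P. emeasure \<nu> (R \<inter> K) = 0 \<longrightarrow> x \<notin> R \<inter> K"
      using countable_regions by (auto simp: AE_ball_countable)
    then show "AE x in \<nu>. x \<in> K \<longrightarrow> x \<in> \<Union>W \<union> large_regions \<nu> P K r"
      using AE_in_partition
    proof eventually_elim
      case (elim x)
      show ?case
      proof
        assume x: "x \<in> K"
        obtain R where R: "R \<in> P" "x \<in> R" using elim by auto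
        then have "emeasure \<nu> (R \<inter> K) > 0"
          using elim x by (auto simp: zero_less_iff_neq_zero)
        then show "x \<in> \<Union>W \<union> large_regions \<nu> P K r"
          using R by (cases "ediam R \<le> ennreal r") (auto simp: W_def large_regions_def)
      qed
    qed
  qed (use large W sets_Union in auto)
  also have "\<dots> \<le> emeasure \<nu> (\<Union>W) + emeasure \<nu> (large_regions \<nu> P K r)"
    using large W sets_Union by (intro emeasure_subadditive)
  also have "\<dots> \<le> emeasure \<nu> (\<Union>W) + ennreal \<eta>"
    using r by (intro add_left_mono)
  finally have kw: "k - \<eta> \<le> w"
    using k w \<eta> by (simp flip: ennreal_plus)

  have "\<Union>(W \<union> bdry W) \<subseteq> U \<union> large_regions \<nu> P C r'"
  proof -
    have "R' \<subseteq> U \<union> large_regions \<nu> P C r'" if R': "R' \<in> bdry W" for R'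
    proof (cases "ediam R' \<le> ennreal r'")
      case True
      obtain R s where R: "R \<in> W" "s \<in> S" "emeasure \<nu> (\<phi> s ` R \<inter> R') \<noteq> 0"
        using R' by (auto simp: vertex_boundary_def approx_edges_def)
      then have "\<phi> s ` R \<inter> R' \<noteq> {}" by (intro notI) simp
      then obtain x where x: "x \<in> \<phi> s ` R" "x \<in> R'" by auto
      then have "x \<in> (\<Union>x\<in>L. ball x \<delta>)"
        using move'[OF R(2,1)] by blast
      then obtain z where z: "z \<in> L" "dist z x < \<delta>"
        by (rule UN_E) simp
      \<comment> \<open>A small boundary region has a point within \<delta> of L and diameter below
        \<delta>, which is why U has to contain the neighbourhood of radius 2 \<delta>.\<close>
      have "R' \<subseteq> (\<Union>x\<in>L. ball x (2 * \<delta>))"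
      proof
        fix y assume "y \<in> R'"
        then have "dist x y \<le> r'"
          using True x r' by (intro ediam_dist_le[of R']) auto
        then have "dist z y < 2 * \<delta>"
          using z r' dist_triangle[of z y x] by linarith
        then show "y \<in> (\<Union>x\<in>L. ball x (2 * \<delta>))"
          using z by auto
      qed
      then show ?thesis using U by blast
    next
      case False
      obtain R s where R: "R \<in> W" "s \<in> S" "emeasure \<nu> (\<phi> s ` R \<inter> R') \<noteq> 0"
        using R' by (auto simp: vertex_boundary_def approx_edges_def)
      have \<delta>: "\<delta> > 0" using r' by linarith
      \<comment> \<open>A large boundary region meets s R in positive measure, and s R lies in C, so
        the region is counted among the large regions of C.\<close>
      have "ball x \<delta> \<subseteq> ball x (2 * \<delta>)" for x :: 'x
        using \<delta> by (intro subset_ball) simp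
      then have "(\<Union>x\<in>L. ball x \<delta>) \<subseteq> C"
        using U by blast
      then have "\<phi> s ` R \<subseteq> C"
        using move'[OF R(2,1)] by (rule order_trans[rotated])
      moreover have R'P: "R' \<in> P"
        using R' bdry_subset by auto
      ultimately have "emeasure \<nu> (\<phi> s ` R \<inter> R') \<le> emeasure \<nu> (R' \<inter> C)"
        using sets sets_region by (intro emeasure_mono) auto
      then have "emeasure \<nu> (R' \<inter> C) > 0"
        using R by (auto simp: zero_less_iff_neq_zero)
      then show ?thesis
        using False R'P by (auto simp: large_regions_def)
    qed
    then show ?thesis
      using near VU by blast
  qed
  then have "emeasure \<nu> (\<Union>(W \<union> bdry W)) \<le> emeasure \<nu> (U \<union> large_regions \<nu> P C r')"
    using sets large by (intro emeasure_mono) auto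
  also have "\<dots> \<le> emeasure \<nu> U + emeasure \<nu> (large_regions \<nu> P C r')"
    using sets large by (intro emeasure_subadditive)
  also have "\<dots> \<le> ennreal (l + \<eta>) + ennreal \<eta>"
    using U r' by (intro add_mono)
  also have "\<dots> = ennreal (l + 2 * \<eta>)"
    using l \<eta> by (simp flip: ennreal_plus)
  finally have "emeasure \<nu> (\<Union>W) + emeasure \<nu> (\<Union>(bdry W)) \<le> ennreal (l + 2 * \<eta>)"
    unfolding emeasure_Un[OF W bdry_subset bdry_disjoint] .
  then obtain b where b: "b \<ge> 0" "emeasure \<nu> (\<Union>(bdry W)) = ennreal b" "w + b \<le> l + 2 * \<eta>"
    using w l \<eta> by (cases "emeasure \<nu> (\<Union>(bdry W))") (auto simp: top_unique simp flip: ennreal_plus)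

  show ?thesis
  proof (cases "k \<le> \<eta>")
    case True
    then have "(1 + \<beta>) * (k - \<eta>) \<le> 0"
      using \<beta> by (intro mult_nonneg_nonpos) auto
    then show ?thesis
      using l \<eta> unfolding \<beta>_def by linarith
  next
    case False
    \<comment> \<open>Here K occupying at most one half is used: the total is at least 2 k and W
      takes at most k + \<eta>, so the regions outside W have measure at least k - \<eta>. Both
      entries of the minimum are thus bounded below.\<close>
    have "ennreal (2 * k) \<le> emeasure \<nu> (\<Union>(W \<union> (P - W)))"
      using ennreal_double_le_if_le_half[of k] half k W by (simp add: Un_absorb1 emeasure_partition)
    also have "\<dots> = ennreal w + emeasure \<nu> (\<Union>(P - W))"
      using W w by (subst emeasure_Un) auto
    finally have "ennreal (k - \<eta>) \<le> emeasure \<nu> (\<Union>(P - W))"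
      using w W_le k \<eta> by (cases "emeasure \<nu> (\<Union>(P - W))") (auto simp flip: ennreal_plus)
    moreover have "ennreal (k - \<eta>) \<le> emeasure \<nu> (\<Union>W)"
      using kw w by (simp add: ennreal_leI)
    ultimately have "ennreal \<beta> * ennreal (k - \<eta>) \<le> ennreal \<beta> * min (emeasure \<nu> (\<Union>W)) (emeasure \<nu> (\<Union>(P - W)))"
      by (intro mult_left_mono) auto
    also have "\<dots> \<le> emeasure \<nu> (\<Union>(bdry W))"
      unfolding \<beta>_def using \<epsilon> h W W_fin by (rule boundary_of_cheeger)
    finally have "\<beta> * (k - \<eta>) \<le> b"
      using b \<beta> False by (simp flip: ennreal_mult)
    then have "(1 + \<beta>) * (k - \<eta>) \<le> l + 2 * \<eta>"
      using kw b(3) by (simp add: distrib_right)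
    then show ?thesis
      unfolding \<beta>_def .
  qed
qed

lemma act_set_compact:
  assumes "finite S" "compact K" "\<And>s. s \<in> S \<Longrightarrow> continuous_on UNIV (\<phi> s)"
  shows "compact (act_set \<phi> S K)"
  unfolding act_set_def using assms
  by (intro compact_UN ballI compact_continuous_image) (auto intro: continuous_on_subset)

text \<open>The order of choices is \<eta>, then V and U, then \<delta> and \<rho> by compactness,
  and finally one index n for which the regions are fine enough. As n depends on \<eta>, the Cheeger
  bound has to be uniform in n.\<close>

lemma compact_expanding:
  fixes \<nu> :: "'x::metric_space measure" and P :: "nat \<Rightarrow> 'x set set"
  assumes part: "\<And>n. approx_partition \<nu> \<phi> S (P n) Q"
    and one: "\<exists>s\<in>S. \<forall>x. \<phi> s x = x"
    and cont: "\<And>s. s \<in> S \<Longrightarrow> continuous_on UNIV (\<phi> s)"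
    and lc: "locally_compact_space (euclidean :: 'x topology)"
    and radon: "radon_measure \<nu>"
    and regions: "\<And>K. compact K \<Longrightarrow>
           \<exists>r :: nat \<Rightarrow> real. decseq r \<and> (\<forall>n. r n > 0) \<and> r \<longlonglongrightarrow> 0 \<and>
             (\<lambda>n. emeasure \<nu> (large_regions \<nu> (P n) K (r n))) \<longlonglongrightarrow> 0"
    and \<epsilon>: "\<epsilon> > 0" and h: "\<And>n. ennreal \<epsilon> \<le> cheeger_constant (P n) (approx_edges \<nu> \<phi> S (P n))"
    and K: "compact K" "emeasure \<nu> K \<le> emeasure \<nu> (space \<nu>) / 2"
  shows "ennreal (1 + \<epsilon> / ((1 + \<epsilon>) * Q\<^sup>2)) * emeasure \<nu> K \<le> emeasure \<nu> (act_set \<phi> S K)"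
proof -
  define \<beta> where "\<beta> = \<epsilon> / ((1 + \<epsilon>) * Q\<^sup>2)"
  have \<beta>: "\<beta> \<ge> 0" using \<epsilon> by (simp add: \<beta>_def)
  have borel: "sets \<nu> = sets borel"
    using radon by (simp add: radon_measure_def)
  have finS: "finite S"
    using part[of 0] by (simp add: approx_partition_def)
  define L where "L = act_set \<phi> S K"
  have L: "compact L"
    unfolding L_def using finS K(1) cont by (rule act_set_compact)
  \<comment> \<open>The identity belongs to S. This puts a neighbourhood of K inside U, so that W
    itself is covered by U and not only its boundary.\<close>
  have KL: "K \<subseteq> L"
    proof
    fix x assume "x \<in> K"
    moreover obtain s where "s \<in> S" "\<phi> s x = x"
      using one by blast
    ultimately show "x \<in> L"
      unfolding L_def act_set_def by (auto intro!: bexI[of _ s] image_eqI[of _ _ x])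
  qed
  obtain k where k: "k \<ge> 0" "emeasure \<nu> K = ennreal k"
    using radon_measure_compact_finite[OF radon K(1)] by (cases "emeasure \<nu> K") auto
  obtain l where l: "l \<ge> 0" "emeasure \<nu> L = ennreal l"
    using radon_measure_compact_finite[OF radon L] by (cases "emeasure \<nu> L") auto
  have approx: "(1 + \<beta>) * (k - \<eta>) \<le> l + 2 * \<eta>" if \<eta>: "\<eta> > 0" for \<eta>
  proof -
    obtain V where V: "open V" "K \<subseteq> V" "emeasure \<nu> V \<le> emeasure \<nu> K + ennreal \<eta>"
      using radon_measure_outer_approx[OF radon lc K(1) \<eta>] by metis
    obtain U C where U: "open U" "compact C" "L \<subseteq> U" "U \<subseteq> C"
      "emeasure \<nu> U \<le> emeasure \<nu> L + ennreal \<eta>"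
      using radon_measure_outer_approx[OF radon lc L \<eta>] .
    obtain \<delta>' where "\<delta>' > 0" "(\<Union>x\<in>L. ball x \<delta>') \<subseteq> U"
      using compact_subset_open_imp_ball_epsilon_subset[OF L U(1,3)] .
    then obtain \<delta> where \<delta>: "\<delta> > 0" "(\<Union>x\<in>L. ball x (2 * \<delta>)) \<subseteq> U"
      using that[of "\<delta>' / 2"] by auto
    \<comment> \<open>V controls the measure of W, U contains W, and the preimages ensure that S
      moves W to within \<delta> of L.\<close>
    define B where "B = V \<inter> U \<inter> (\<Inter>s\<in>S. \<phi> s -` (\<Union>x\<in>L. ball x \<delta>))"
    have "open B"
      unfolding B_def using V U finS cont
      by (intro open_Int open_INT ballI open_vimage) auto
    moreover have "K \<subseteq> B"
    proof -
      have "\<phi> s x \<in> (\<Union>y\<in>L. ball y \<delta>)" if "x \<in> K" "s \<in> S" for x s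
        using that \<delta>(1) by (intro UN_I[of "\<phi> s x"]) (auto simp: L_def act_set_def)
      then have "K \<subseteq> (\<Inter>s\<in>S. \<phi> s -` (\<Union>x\<in>L. ball x \<delta>))"
        by (intro subsetI INT_I vimageI2)
      moreover have "K \<subseteq> U"
        using KL U(3) by (rule order_trans)
      ultimately show ?thesis
        unfolding B_def using V(2) by (intro Int_greatest)
    qed
    ultimately obtain \<rho> where \<rho>: "\<rho> > 0" "(\<Union>x\<in>K. ball x \<rho>) \<subseteq> B"
      using compact_subset_open_imp_ball_epsilon_subset[OF K(1)] by metis
    have ev: "\<forall>\<^sub>F n in sequentially. 0 < r n \<and> r n < t \<and> emeasure \<nu> (large_regions \<nu> (P n) A (r n)) \<le> ennreal \<eta>"
      if "\<forall>n. r n > 0" "r \<longlonglongrightarrow> 0" "(\<lambda>n. emeasure \<nu> (large_regions \<nu> (P n) A (r n))) \<longlonglongrightarrow> 0" "t > 0"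
      for r A t
    proof -
      have "ennreal \<eta> > 0"
        using \<eta> by simp
      from order_tendstoD(2)[OF that(3) this] order_tendstoD(2)[OF that(2,4)] show ?thesis
        by eventually_elim (use that(1) in auto)
    qed
    obtain r where r: "\<forall>n. r n > 0" "r \<longlonglongrightarrow> 0" "(\<lambda>n. emeasure \<nu> (large_regions \<nu> (P n) K (r n))) \<longlonglongrightarrow> 0"
      using regions[OF K(1)] by auto
    \<comment> \<open>The second sequence belongs to C; both are eventually good, so they share an
      index n.\<close>
    obtain r' where r': "\<forall>n. r' n > 0" "r' \<longlonglongrightarrow> 0" "(\<lambda>n. emeasure \<nu> (large_regions \<nu> (P n) C (r' n))) \<longlonglongrightarrow> 0"
      using regions[OF U(2)] by auto
    obtain n where n: "0 < r n" "r n < \<rho>" "emeasure \<nu> (large_regions \<nu> (P n) K (r n)) \<le> ennreal \<eta>"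
      "0 < r' n" "r' n < \<delta>" "emeasure \<nu> (large_regions \<nu> (P n) C (r' n)) \<le> ennreal \<eta>"
      using eventually_happens'[OF _ eventually_conj[OF ev[OF r \<rho>(1)] ev[OF r' \<delta>(1)]]] by auto
    show ?thesis
      unfolding \<beta>_def
    proof (rule expanding_up_to_error[OF part \<epsilon> h, where K = K and C = C and V = V and U = U and L = L])
      show "K \<in> sets \<nu>" "C \<in> sets \<nu>" "V \<in> sets \<nu>" "U \<in> sets \<nu>"
        using K V U by (auto simp: borel intro: borel_compact)
      show "emeasure \<nu> V \<le> ennreal (k + \<eta>)" "emeasure \<nu> U \<le> ennreal (l + \<eta>)"
        using V(3) U(5) k l \<eta> by (auto simp flip: ennreal_plus)
      show "(\<Union>x\<in>K. ball x \<rho>) \<subseteq> V" "(\<Union>x\<in>K. ball x \<rho>) \<subseteq> U"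
        using \<rho> by (auto simp: B_def)
      show "\<phi> s ` (\<Union>x\<in>K. ball x \<rho>) \<subseteq> (\<Union>x\<in>L. ball x \<delta>)" if "s \<in> S" for s
        using \<rho>(2) that unfolding B_def by blast
    qed (use K U \<delta> n k l \<eta> in auto)
  qed
  have "(1 + \<beta>) * k \<le> l + e" if e: "e > 0" for e
  proof -
    \<comment> \<open>The total error (1 + \<beta>) \<eta> + 2 \<eta> equals e.\<close>
    define \<eta> where "\<eta> = e / (3 + \<beta>)"
    have "\<eta> > 0" "\<eta> * (3 + \<beta>) = e"
      using e \<beta> by (auto simp: \<eta>_def)
    then show ?thesis
      using approx[of \<eta>] by (simp add: algebra_simps)
  qed
  then have "(1 + \<beta>) * k \<le> l"
    by (rule field_le_epsilon)
  then have "ennreal (1 + \<beta>) * emeasure \<nu> K \<le> emeasure \<nu> L"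
    unfolding k(2) l(2) using k(1) l(1) \<beta> by (subst ennreal_mult[symmetric]) auto
  then show ?thesis
    unfolding L_def \<beta>_def .
qed

section \<open>The equivalence\<close>

theorem theoremA:
  fixes G :: "('g, 'b) monoid_scheme"
    and S :: "'g set"
    and \<phi> :: "'g \<Rightarrow> 'x::metric_space \<Rightarrow> 'x"
    and \<nu> :: "'x measure"
    and P :: "nat \<Rightarrow> 'x set set"
  assumes "group G"
    and "S \<subseteq> carrier G" and "finite S" and "generate G S = carrier G"
    and "\<And>s. s \<in> S \<Longrightarrow> inv\<^bsub>G\<^esub> s \<in> S" and "\<one>\<^bsub>G\<^esub> \<in> S"
    and "locally_compact_space (euclidean :: 'x topology)"
    and "radon_measure \<nu>"
    and "continuous_action G \<phi>"
    and "\<And>n. measurable_partition \<nu> (P n)"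
    and "\<exists>Q\<ge>1. \<forall>n. measure_ratios_bounded \<nu> Q (P n)"
    and "\<And>n. simplicial_graph (P n) (approx_edges \<nu> \<phi> S (P n))"
    and "\<And>K. compact K \<Longrightarrow>
           \<exists>r :: nat \<Rightarrow> real. decseq r \<and> (\<forall>n. r n > 0) \<and> r \<longlonglongrightarrow> 0 \<and>
             (\<lambda>n. emeasure \<nu> (large_regions \<nu> (P n) K (r n))) \<longlonglongrightarrow> 0"
  shows "expanding_in_measure \<nu> \<phi> S \<longleftrightarrow>
           (\<exists>\<epsilon>::real. \<epsilon> > 0 \<and>
             (\<forall>n. cheeger_constant (P n) (approx_edges \<nu> \<phi> S (P n)) \<ge> ennreal \<epsilon>))"
proof -
  interpret action: group_action G UNIV \<phi>
    using assms(9) by (simp add: continuous_action_def)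
  obtain Q where Q: "Q \<ge> 1" "\<And>n. measure_ratios_bounded \<nu> Q (P n)"
    using assms(11) by blast
  have borel: "sets \<nu> = sets borel"
    using assms(8) by (simp add: radon_measure_def)
  have homeo: "homeomorphic_map euclidean euclidean (\<phi> s)" if "s \<in> S" for s
    using assms(2,9) that by (auto simp: continuous_action_def)
  have cont: "continuous_on UNIV (\<phi> s)" if "s \<in> S" for s
    using homeomorphic_imp_continuous_map[OF homeo[OF that]] by simp
  have image_sets: "\<phi> s ` A \<in> sets \<nu>" if s: "s \<in> S" and A: "A \<in> sets \<nu>" for s A
  proof -
    obtain g where g: "homeomorphic_maps euclidean euclidean (\<phi> s) g"
      using homeo[OF s] by (auto simp: homeomorphic_map_maps)
    then have inv: "g (\<phi> s x) = x" "\<phi> s (g x) = x" for x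
      by (auto simp: homeomorphic_maps_def)
    have "continuous_on UNIV g"
      using g by (simp add: homeomorphic_maps_def)
    then have "g -` A \<in> sets \<nu>"
      using measurable_sets[OF borel_measurable_continuous_onI, of g A] A by (simp add: borel)
    \<comment> \<open>The image under a homeomorphism is the preimage under its continuous inverse,
      hence Borel.\<close>
    also have "g -` A = \<phi> s ` A"
      using inv by (auto simp: image_iff) metis
    finally show ?thesis .
  qed
  have part: "approx_partition \<nu> \<phi> S (P n) Q" for n
    using assms(3,10,12) Q image_sets by unfold_locales auto
  have one: "\<exists>s\<in>S. \<forall>x. \<phi> s x = x"
    using assms(6) action.id_eq_one by (metis UNIV_I restrict_apply)
  show ?thesis
  proof
    assume "expanding_in_measure \<nu> \<phi> S"
    then obtain \<alpha> :: real where \<alpha>: "\<alpha> > 0" and exp: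
      "\<And>A. A \<in> sets \<nu> \<Longrightarrow> emeasure \<nu> A < \<infinity> \<Longrightarrow> emeasure \<nu> A \<le> emeasure \<nu> (space \<nu>) / 2 \<Longrightarrow>
          ennreal (1 + \<alpha>) * emeasure \<nu> A \<le> emeasure \<nu> (act_set \<phi> S A)"
      unfolding expanding_in_measure_def by blast
    \<comment> \<open>The bound depends on n only through Q, which is common to all
      partitions.\<close>
    have "ennreal (\<alpha> / (\<alpha> + Q\<^sup>2)) \<le> cheeger_constant (P n) (approx_edges \<nu> \<phi> S (P n))" for n
      by (rule approx_partition.cheeger_of_expanding[OF part \<alpha> exp])
    moreover have "\<alpha> / (\<alpha> + Q\<^sup>2) > 0"
      using \<alpha> by (simp add: add_pos_nonneg)
    ultimately show "\<exists>\<epsilon>::real. \<epsilon> > 0 \<and>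
        (\<forall>n. cheeger_constant (P n) (approx_edges \<nu> \<phi> S (P n)) \<ge> ennreal \<epsilon>)"
      by blast
  next
    assume "\<exists>\<epsilon>::real. \<epsilon> > 0 \<and>
        (\<forall>n. cheeger_constant (P n) (approx_edges \<nu> \<phi> S (P n)) \<ge> ennreal \<epsilon>)"
    then obtain \<epsilon> :: real where \<epsilon>: "\<epsilon> > 0"
      and h: "\<And>n. ennreal \<epsilon> \<le> cheeger_constant (P n) (approx_edges \<nu> \<phi> S (P n))"
      by blast
    define \<beta> where "\<beta> = \<epsilon> / ((1 + \<epsilon>) * Q\<^sup>2)"
    have "ennreal (1 + \<beta>) * emeasure \<nu> A \<le> emeasure \<nu> (act_set \<phi> S A)"
      if A: "A \<in> sets \<nu>" "emeasure \<nu> A \<le> emeasure \<nu> (space \<nu>) / 2" for A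
    proof -
      have SA: "act_set \<phi> S A \<in> sets \<nu>"
        unfolding act_set_def using assms(3) image_sets A(1) by (intro sets.finite_UN) auto
      have "emeasure \<nu> A = (SUP K \<in> {K. compact K \<and> K \<subseteq> A}. emeasure \<nu> K)"
        using assms(8) A(1) by (simp add: radon_measure_def)
      \<comment> \<open>Compact subsets of A inherit the bound by one half and their S-images lie in
        that of A, so expansion passes to the supremum.\<close>
      then have "ennreal (1 + \<beta>) * emeasure \<nu> A =
          (SUP K \<in> {K. compact K \<and> K \<subseteq> A}. ennreal (1 + \<beta>) * emeasure \<nu> K)"
        by (simp add: SUP_mult_left_ennreal)
      also have "\<dots> \<le> emeasure \<nu> (act_set \<phi> S A)"
      proof (rule SUP_least, clarify)
        fix K assume K: "compact K" "K \<subseteq> A"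
        have "emeasure \<nu> K \<le> emeasure \<nu> A"
          using K A(1) by (intro emeasure_mono)
        then have "emeasure \<nu> K \<le> emeasure \<nu> (space \<nu>) / 2"
          using A(2) by (rule order_trans)
        then have "ennreal (1 + \<beta>) * emeasure \<nu> K \<le> emeasure \<nu> (act_set \<phi> S K)"
          unfolding \<beta>_def by (intro compact_expanding[OF part one cont assms(7,8,13) \<epsilon> h K(1)])
        also have "\<dots> \<le> emeasure \<nu> (act_set \<phi> S A)"
          using K SA by (intro emeasure_mono) (auto simp: act_set_def)
        finally show "ennreal (1 + \<beta>) * emeasure \<nu> K \<le> emeasure \<nu> (act_set \<phi> S A)" .
      qed
      finally show ?thesis .
    qed
    moreover have "\<beta> > 0"
      using \<epsilon> Q by (simp add: \<beta>_def)
    ultimately show "expanding_in_measure \<nu> \<phi> S"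
      unfolding expanding_in_measure_def by blast
  qed
qed

end
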